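(* Let $\mathbf{A}\in\mathbb{C}^{m\times m}$ with $\operatorname{Ind}\mathbf{A}=k$ and $\operatorname{rank}\mathbf{A}^{k+1}=\operatorname{rank}\mathbf{A}^{k}=r$, where $1\le r\le m$, and let $\mathbf{B}\in\mathbb{C}^{n\times m}$. Put $\check{\mathbf{B}}=\mathbf{B}\mathbf{A}^{k}\in\mathbb{C}^{n\times m}$ and let $\check{\mathbf{b}}_{i.}$ be its $i$th row. Then the Drazin inverse solution $\mathbf{X}=\mathbf{B}\mathbf{A}^{D}=(x_{ij})\in\mathbb{C}^{n\times m}$ of the matrix equation $\mathbf{X}\mathbf{A}=\mathbf{B}$ satisfies $$x_{ij}=\frac{\sum_{\alpha\in I_{r,m}\{j\}}\left|\left(\mathbf{A}^{k+1}_{j.}\left(\check{\mathbf{b}}_{i.}\right)\right)^{\alpha}_{\alpha}\right|}{\sum_{\alpha\in I_{r,m}}\left|\left(\mathbf{A}^{k+1}\right)^{\alpha}_{\alpha}\right|}$$ for all $i=1,\dots,n$ and $j=1,\dots,m$.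
   Context: For a square complex matrix $\mathbf{A}$, the index $\operatorname{Ind}\mathbf{A}$ is the smallest nonnegative integer $k$ with $\operatorname{rank}\mathbf{A}^{k+1}=\operatorname{rank}\mathbf{A}^{k}$. The Drazin inverse $\mathbf{A}^{D}$ of a matrix with $\operatorname{Ind}\mathbf A=k$ is the unique matrix $\mathbf{X}$ satisfying $\mathbf{A}^{k+1}\mathbf{X}=\mathbf{A}^{k}$, $\mathbf{X}\mathbf{A}\mathbf{X}=\mathbf{X}$, $\mathbf{A}\mathbf{X}=\mathbf{X}\mathbf{A}$. The "Drazin inverse solution" of $\mathbf{X}\mathbf{A}=\mathbf{B}$ means, by definition, the matrix $\mathbf{B}\mathbf{A}^{D}$. Notation: for a matrix $\mathbf{M}$ and a row vector $\mathbf{b}$, $\mathbf{M}_{j.}(\mathbf{b})$ is the matrix obtained from $\mathbf{M}$ by replacing its $j$th row with $\mathbf{b}$; $\mathbf{A}^{k+1}_{j.}(\mathbf{b})$ means $(\mathbf{A}^{k+1})_{j.}(\mathbf{b})$. $|\mathbf{M}^{\alpha}_{\alpha}|$ is the principal minor of $\mathbf{M}$ with rows and columns indexed by $\alpha$. For $1\le r\le m$, $I_{r,m}$ is the set of all strictly increasing sequences of $r$ integers from $\{1,\dots,m\}$ (equivalently, $r$-element subsets), and $I_{r,m}\{j\}=\{\alpha\in I_{r,m}: j\in\alpha\}$. *)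

theory Defs
  imports
    Complex_Main
    "Jordan_Normal_Form.Determinant"
    "Jordan_Normal_Form.DL_Rank"
    "Jordan_Normal_Form.DL_Submatrix"
begin

abbreviation mat_rank :: "complex mat \<Rightarrow> nat" where
  "mat_rank A \<equiv> vec_space.rank (dim_row A) A"

definition mat_index :: "complex mat \<Rightarrow> nat" where
  "mat_index A = (LEAST k. mat_rank (A ^\<^sub>m (k + 1)) = mat_rank (A ^\<^sub>m k))"

definition is_drazin_inverse :: "complex mat \<Rightarrow> complex mat \<Rightarrow> bool" where
  "is_drazin_inverse A X \<longleftrightarrow>
     X \<in> carrier_mat (dim_row A) (dim_row A) \<and>
     A ^\<^sub>m (mat_index A + 1) * X = A ^\<^sub>m (mat_index A) \<and>
     X * A * X = X \<and>
     A * X = X * A"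

text \<open>Meaningful for square matrices only, where existence and uniqueness hold.\<close>

definition drazin_inverse :: "complex mat \<Rightarrow> complex mat" where
  "drazin_inverse A = (THE X. is_drazin_inverse A X)"

text \<open>The row analogue of \<^const>\<open>replace_col\<close>, with the same argument order.\<close>

definition replace_row :: "'a mat \<Rightarrow> 'a vec \<Rightarrow> nat \<Rightarrow> 'a mat" where
  "replace_row M b j =
     mat (dim_row M) (dim_col M) (\<lambda>(p, q). if p = j then b $ q else M $$ (p, q))"

definition principal_minor :: "'a :: comm_ring_1 mat \<Rightarrow> nat set \<Rightarrow> 'a" where
  "principal_minor M \<alpha> = det (submatrix M \<alpha> \<alpha>)"

text \<open>Strictly increasing sequences are represented by their ranges. Matrix indices
  start at 0, so \<open>{0..<m}\<close> plays the role of \<open>{1, \<dots>, m}\<close>.\<close>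

definition index_sets :: "nat \<Rightarrow> nat \<Rightarrow> nat set set" where
  "index_sets r m = {\<alpha>. \<alpha> \<subseteq> {0..<m} \<and> card \<alpha> = r}"

definition index_sets_containing :: "nat \<Rightarrow> nat \<Rightarrow> nat \<Rightarrow> nat set set" where
  "index_sets_containing r m j = {\<alpha> \<in> index_sets r m. j \<in> \<alpha>}"

end

theory Submission
  imports Defs
    "Jordan_Normal_Form.Jordan_Normal_Form_Existence"
    "Jordan_Normal_Form.Jordan_Normal_Form_Uniqueness"
    "Subresultants.More_Homomorphisms"
begin

text \<open>
  Put \<open>M = A\<^sup>k\<^sup>+\<^sup>1\<close>, \<open>D(t) = tI + M\<close>, \<open>s = m - r\<close>, and write \<open>d\<^sub>l\<close> and \<open>C\<^sub>l\<close> for the coefficients of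
  \<open>t\<^sup>l\<close> in \<open>det D\<close> and in the adjugate of \<open>D\<close>. Since \<open>ker M = ker M\<^sup>2\<close> has dimension \<open>s\<close>, the
  root \<open>0\<close> of \<open>det D\<close> has order exactly \<open>s\<close>, so \<open>d\<^sub>l = 0\<close> for \<open>l < s\<close> and \<open>d\<^sub>s \<noteq> 0\<close>.
  Comparing coefficients in \<open>D adj D = det D I\<close> gives \<open>M C\<^sub>l + C\<^sub>l\<^sub>-\<^sub>1 = d\<^sub>l I\<close>. For \<open>l < s\<close> this shows
  \<open>M\<^sup>s C\<^sub>s\<^sub>-\<^sub>1 = 0\<close>, hence \<open>A\<^sup>k C\<^sub>s\<^sub>-\<^sub>1 = 0\<close>, and then \<open>A\<^sup>k M C\<^sub>s = d\<^sub>s A\<^sup>k\<close>. As \<open>C\<^sub>s\<close> commutes with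
  \<open>A\<close>, it follows that \<open>A\<^sup>k C\<^sub>s / d\<^sub>s\<close> is the Drazin inverse of \<open>A\<close>. So \<open>x\<^sub>i\<^sub>j\<close> is the coefficient of
  \<open>t\<^sup>s\<close> in entry \<open>j\<close> of \<open>b adj D\<close>, with \<open>b\<close> row \<open>i\<close> of \<open>B A\<^sup>k\<close>, divided by \<open>d\<^sub>s\<close>. That entry is the
  determinant of \<open>D\<close> with row \<open>j\<close> replaced by \<open>b\<close>, and both determinants expand over principal minors.
\<close>

section \<open>Powers, kernels and the eigenvalue zero\<close>

lemma pow_mat_add:
  fixes A :: "'a :: semiring_1 mat"
  assumes A: "A \<in> carrier_mat n n"
  shows "A ^\<^sub>m (k + l) = A ^\<^sub>m k * A ^\<^sub>m l"
proof (induction l)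
  case (Suc l)
  have "A ^\<^sub>m (k + Suc l) = A ^\<^sub>m k * A ^\<^sub>m l * A" using Suc by simp
  also have "\<dots> = A ^\<^sub>m k * A ^\<^sub>m Suc l" using A by (simp add: assoc_mult_mat[of _ n n _ n _ n])
  finally show ?case .
qed (use A in simp)

lemma pow_mat_commute:
  fixes A :: "'a :: semiring_1 mat"
  assumes A: "A \<in> carrier_mat n n"
  shows "A * A ^\<^sub>m k = A ^\<^sub>m k * A"
  using pow_mat_add[OF A, of 1 k] pow_mat_add[OF A, of k 1] A by simp

lemma pow_mat_commute_pow:
  fixes U V :: "'a :: semiring_1 mat"
  assumes UV: "U * V = V * U" and U: "U \<in> carrier_mat n n" and V: "V \<in> carrier_mat n n"
  shows "U ^\<^sub>m i * V ^\<^sub>m j = V ^\<^sub>m j * U ^\<^sub>m i"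
proof -
  note as = assoc_mult_mat[of _ n n _ n _ n] mult_carrier_mat[of _ n n _ n]
  have 1: "U * V ^\<^sub>m j = V ^\<^sub>m j * U"
  proof (induction j)
    case (Suc j)
    have "U * V ^\<^sub>m Suc j = U * V ^\<^sub>m j * V" using U V by (simp add: as)
    also have "\<dots> = V ^\<^sub>m j * (U * V)" unfolding Suc using U V by (simp add: as)
    also have "\<dots> = V ^\<^sub>m Suc j * U" unfolding UV using U V by (simp add: as)
    finally show ?case .
  qed (use U V in simp)
  show ?thesis
  proof (induction i)
    case (Suc i)
    have "U ^\<^sub>m Suc i * V ^\<^sub>m j = U ^\<^sub>m i * (V ^\<^sub>m j * U)" using U V by (simp add: as 1)
    also have "\<dots> = V ^\<^sub>m j * U ^\<^sub>m Suc i" using U V Suc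
      by (simp add: assoc_mult_mat[of _ n n _ n _ n, symmetric] mult_carrier_mat[of _ n n _ n])
    finally show ?case .
  qed (use U V in simp)
qed

lemma pow_mat_mult:
  fixes A :: "'a :: semiring_1 mat"
  assumes A: "A \<in> carrier_mat n n"
  shows "(A ^\<^sub>m k) ^\<^sub>m l = A ^\<^sub>m (k * l)"
  by (induction l) (use A in \<open>simp_all add: pow_mat_add[OF A, symmetric] add.commute\<close>)

text \<open>Rank-nullity for the map sending v to \<open>A *\<^sub>v v\<close>: its image is the
  column space, its kernel \<open>mat_kernel A\<close>. It turns rank hypotheses into kernel
  dimensions.\<close>

lemma rank_plus_kernel_dim:
  fixes A :: "'a :: field mat"
  assumes A: "A \<in> carrier_mat nr nc"
  shows "vec_space.rank nr A + kernel_dim A = nc"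
proof -
  interpret R: vec_space "TYPE('a)" nr .
  interpret K: kernel nr nc A by unfold_locales (rule A)
  interpret L: linear_map class_ring "module_vec TYPE('a) nc" "module_vec TYPE('a) nr" "\<lambda>v. A *\<^sub>v v"
  proof (unfold_locales, goal_cases)
    case 1
    show ?case unfolding LinearCombinations.module_hom_def
      using A by (auto simp: module_vec_simps mult_add_distrib_mat_vec[OF A] mult_mat_vec[OF A])
  qed
  have im: "L.imT = R.span (set (cols A))"
    unfolding R.col_space_def[symmetric] R.col_space_eq[OF A] L.im_def
    using A by (auto simp: module_vec_simps)
  have ke: "L.kerT = mat_kernel A"
    unfolding mat_kernel[OF A] L.ker_def by (auto simp: module_vec_simps)
  have "vectorspace.dim class_ring (R.V\<lparr>carrier := L.imT\<rparr>) + vectorspace.dim class_ring (K.NC.V\<lparr>carrier := L.kerT\<rparr>)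
    = K.NC.dim" by (rule L.rank_nullity) (rule K.NC.fin_dim)
  thus ?thesis unfolding im ke R.rank_def kernel_dim_def using A
    by (simp add: K.NC.dim_is_n)
qed

text \<open>A basis of the smaller kernel stays independent in the larger one and has the size of
  its dimension, so it spans both.\<close>

lemma mat_kernel_eqI:
  fixes A :: "'a :: field mat"
  assumes A: "A \<in> carrier_mat nr nc" and B: "B \<in> carrier_mat nr' nc"
    and sub: "mat_kernel A \<subseteq> mat_kernel B" and dim: "kernel_dim A = kernel_dim B"
  shows "mat_kernel A = mat_kernel B"
proof -
  interpret KA: kernel nr nc A by unfold_locales (rule A)
  interpret KB: kernel nr' nc B by unfold_locales (rule B)
  obtain b where b: "finite b" "KA.basis b" using kernel_basis_exists[OF A] by auto
  have bA: "b \<subseteq> mat_kernel A" "KA.lin_indpt b" "KA.span b = mat_kernel A"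
    using b(2) unfolding KA.Ker.basis_def by auto
  have bB: "b \<subseteq> mat_kernel B" using bA(1) sub by auto
  have li: "KB.lin_indpt b"
    using bA(2) KA.lindep_same[OF bA(1)] KB.lindep_same[OF bB] by simp
  have card: "card b = KB.dim"
    using KA.Ker.dim_basis[OF b] dim by simp
  have "KB.Ker.fin_dim"
  proof -
    obtain c where c: "finite c" "KB.basis c" using kernel_basis_exists[OF B] by auto
    thus ?thesis unfolding KB.Ker.fin_dim_def KB.Ker.basis_def by auto
  qed
  hence "KB.basis b"
    using KB.Ker.dim_li_is_basis[OF _ b(1)] bB li card by auto
  hence "KB.span b = mat_kernel B" unfolding KB.Ker.basis_def by auto
  thus ?thesis using bA(3) KA.span_same[OF bA(1)] KB.span_same[OF bB] by simp
qed

text \<open>In Jordan form the kernel of \<open>A ^\<^sub>m l\<close> has dimension the sum of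
  \<open>min l n\<close> over the sizes n of the blocks for eigenvalue 0. Equality at l = 1 and l =
  2 leaves only blocks of size at most 1, so algebraic and geometric multiplicity agree.\<close>

lemma order_0_char_poly_eq_kernel_dim:
  fixes A :: "complex mat"
  assumes A: "A \<in> carrier_mat n n" and dim: "kernel_dim (A * A) = kernel_dim A"
  shows "order 0 (char_poly A) = kernel_dim A"
proof -
  obtain as where "char_poly A = (\<Prod> a \<leftarrow> as. [:- a, 1:])"
    using char_poly_factorized[OF A] by auto
  with jordan_nf_exists[OF A] obtain n_as where jnf: "jordan_nf A n_as" by auto
  let ?ns = "map fst (filter (\<lambda>na. snd na = 0) n_as)"
  have cm: "char_matrix A 0 = A" unfolding char_matrix_def using A by (intro eq_matI) auto
  have eq: "[(n, e)\<leftarrow>n_as . e = (0::complex)] = filter (\<lambda>na. snd na = 0) n_as"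
    by (rule filter_cong) auto
  have gen: "kernel_dim (A ^\<^sub>m l) = (\<Sum>n\<leftarrow>?ns. min l n)" for l
    using dim_gen_eigenspace[OF jnf, of 0 l] unfolding dim_gen_eigenspace_def cm eq .
  have "A ^\<^sub>m 1 = A" "A ^\<^sub>m 2 = A * A" using A by (auto simp: numeral_2_eq_2)
  with gen[of 1] gen[of 2] dim have s: "(\<Sum>n\<leftarrow>?ns. min 1 n) = (\<Sum>n\<leftarrow>?ns. min 2 n)"
    and d: "kernel_dim A = (\<Sum>n\<leftarrow>?ns. min 1 n)" by simp_all
  \<comment> \<open>The summands compare termwise, so equal sums force
    \<open>min 1 n = min 2 n\<close> for every n.\<close>
  have small: "n \<le> 1" if "n \<in> set ns" "(\<Sum>n\<leftarrow>ns. min 1 n) = (\<Sum>n\<leftarrow>ns. min 2 n)" for n and ns :: "nat list"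
    using that
  proof (induction ns)
    case (Cons a ns)
    have "(\<Sum>n\<leftarrow>ns. min 1 n) \<le> (\<Sum>n\<leftarrow>ns. min 2 n)" by (rule sum_list_mono) auto
    with Cons.prems(2) have "min 1 a = min 2 a" "(\<Sum>n\<leftarrow>ns. min 1 n) = (\<Sum>n\<leftarrow>ns. min 2 n)" by auto
    with Cons show ?case by auto
  qed auto
  have "map (min 1) ?ns = ?ns"
    by (rule map_idI) (use small[OF _ s] in \<open>simp add: min_absorb2\<close>)
  thus ?thesis unfolding jordan_nf_order[OF jnf] d by (simp only:)
qed

text \<open>Each column of \<open>Z\<close> lies in the kernel of \<open>A\<close>, hence in that of
  \<open>B\<close>. This lets a high power of the matrix be replaced by a lower one with the same
  kernel.\<close>

lemma mult_mat_eq_0_imp: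
  fixes A :: "'a :: field mat"
  assumes A: "A \<in> carrier_mat nr nc" and B: "B \<in> carrier_mat nr nc" and Z: "Z \<in> carrier_mat nc p"
    and ker: "mat_kernel A \<subseteq> mat_kernel B" and 0: "A * Z = 0\<^sub>m nr p"
  shows "B * Z = 0\<^sub>m nr p"
proof (rule eq_matI)
  fix i j assume ij: "i < dim_row (0\<^sub>m nr p)" "j < dim_col (0\<^sub>m nr p)"
  have "A *\<^sub>v col Z j = col (A * Z) j" using A Z ij by auto
  also have "\<dots> = 0\<^sub>v nr" unfolding 0 using ij by auto
  finally have "col Z j \<in> mat_kernel B" using ker Z mat_kernelI[OF A] col_carrier_vec ij by auto
  hence "B *\<^sub>v col Z j = 0\<^sub>v nr" by (rule mat_kernelD(2)[OF B])
  from arg_cong[OF this, of "\<lambda>v. v $ i"] show "(B * Z) $$ (i,j) = 0\<^sub>m nr p $$ (i,j)" using B Z ij by simp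
qed (use B Z in auto)

text \<open>Once two consecutive kernels agree, the chain is constant: if the power k + l + 1 kills
  v, then \<open>A ^\<^sub>m l *\<^sub>v v\<close> lies in the kernel of the power k + 1, hence of
  the power k.\<close>

lemma mat_kernel_pow_stable:
  fixes A :: "'a :: field mat"
  assumes A: "A \<in> carrier_mat n n" and dim: "kernel_dim (A ^\<^sub>m (k + 1)) = kernel_dim (A ^\<^sub>m k)"
  shows "mat_kernel (A ^\<^sub>m (k + l)) = mat_kernel (A ^\<^sub>m k)"
proof -
  have P: "A ^\<^sub>m i \<in> carrier_mat n n" for i using A by simp
  have "A ^\<^sub>m (k + i) = A ^\<^sub>m i * A ^\<^sub>m k" for i
    using pow_mat_add[OF A, of i k] by (simp add: add.commute)
  hence sub: "mat_kernel (A ^\<^sub>m k) \<subseteq> mat_kernel (A ^\<^sub>m (k + i))" for i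
    using mat_kernel_mult_subset[OF P P] by simp
  have step: "mat_kernel (A ^\<^sub>m (k + 1)) = mat_kernel (A ^\<^sub>m k)"
    using mat_kernel_eqI[OF P P sub dim[symmetric]] by simp
  have "mat_kernel (A ^\<^sub>m (k + l)) \<subseteq> mat_kernel (A ^\<^sub>m k)"
  proof (induction l)
    case (Suc l)
    show ?case
    proof
      fix v assume "v \<in> mat_kernel (A ^\<^sub>m (k + Suc l))"
      note v = mat_kernelD[OF P this]
      have "A ^\<^sub>m (k + Suc l) = A ^\<^sub>m (k + 1) * A ^\<^sub>m l" "A ^\<^sub>m (k + l) = A ^\<^sub>m k * A ^\<^sub>m l"
        using pow_mat_add[OF A, of "k + 1" l] pow_mat_add[OF A, of k l] by simp_all
      hence eq: "A ^\<^sub>m (k + Suc l) *\<^sub>v v = A ^\<^sub>m (k + 1) *\<^sub>v (A ^\<^sub>m l *\<^sub>v v)"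
        "A ^\<^sub>m (k + l) *\<^sub>v v = A ^\<^sub>m k *\<^sub>v (A ^\<^sub>m l *\<^sub>v v)"
        using assoc_mult_mat_vec[OF P P v(1)] by metis+
      have Pv: "A ^\<^sub>m l *\<^sub>v v \<in> carrier_vec n" using mult_mat_vec_carrier[OF P v(1)] .
      have "A ^\<^sub>m l *\<^sub>v v \<in> mat_kernel (A ^\<^sub>m (k + 1))"
        by (rule mat_kernelI[OF P Pv]) (use v(2) eq(1) in simp)
      hence "A ^\<^sub>m k *\<^sub>v (A ^\<^sub>m l *\<^sub>v v) = 0\<^sub>v n" unfolding step by (rule mat_kernelD(2)[OF P])
      hence "v \<in> mat_kernel (A ^\<^sub>m (k + l))" using eq(2) by (intro mat_kernelI[OF P v(1)]) simp
      thus "v \<in> mat_kernel (A ^\<^sub>m k)" using Suc by auto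
    qed
  qed simp
  with sub show ?thesis by blast
qed

lemma kernel_dim_cong:
  "dim_col A = dim_col B \<Longrightarrow> mat_kernel A = mat_kernel B \<Longrightarrow> kernel_dim A = kernel_dim B"
  by (simp add: kernel_dim_def)

lemma mat_kernel_uminus:
  fixes A :: "'a :: comm_ring_1 mat"
  shows "mat_kernel (- A) = mat_kernel A"
proof -
  have "(- A) *\<^sub>v v = - (A *\<^sub>v v)" if "v \<in> carrier_vec (dim_col A)" for v
    using that by (intro eq_vecI) auto
  moreover have "- w = 0\<^sub>v (dim_row A) \<longleftrightarrow> w = 0\<^sub>v (dim_row A)" if "w \<in> carrier_vec (dim_row A)" for w :: "'a vec"
    using that by (metis uminus_uminus_vec uminus_zero_vec)
  moreover have "A *\<^sub>v v \<in> carrier_vec (dim_row A)" for v by (auto intro: carrier_vecI)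
  ultimately show ?thesis unfolding mat_kernel_def by auto
qed

section \<open>Expansion of determinants over principal minors\<close>

lemma bij_betw_pick:
  assumes "finite S"
  shows "bij_betw (pick S) {0..<card S} S"
proof -
  have inj: "inj_on (pick S) {0..<card S}"
    by (rule inj_onI) (metis atLeastLessThan_iff linorder_neqE_nat nat_less_le pick_mono_le)
  have "pick S ` {0..<card S} \<subseteq> S" by (auto intro: pick_in_set_le)
  moreover have "card (pick S ` {0..<card S}) = card S" using card_image[OF inj] by simp
  ultimately have "pick S ` {0..<card S} = S" using assms card_subset_eq by metis
  with inj show ?thesis by (simp add: bij_betw_def)
qed

text \<open>The Leibniz formula with original row labels. Transport along \<open>pick S\<close>
  keeps signs and turns permutations of positions into permutations of \<open>S\<close>, which also
  act on the full index range.\<close>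

lemma principal_minor_permutes:
  assumes K: "K \<in> carrier_mat m m" and S: "S \<subseteq> {0..<m}"
  shows "principal_minor K S = (\<Sum>p | p permutes S. signof p * (\<Prod>i\<in>S. K $$ (i, p i)))"
proof -
  let ?R = "{0..<card S}"
  have fin: "finite S" using S finite_subset by blast
  note bij = bij_betw_pick[OF fin]
  hence inj: "inj_on (pick S) ?R" and img: "pick S ` ?R = S" by (auto simp: bij_betw_def)
  have eq: "{i. i < m \<and> i \<in> S} = S" using S by auto
  have sub: "submatrix K S S \<in> carrier_mat (card S) (card S)"
    using K by (intro carrier_matI) (auto simp: dim_submatrix eq)
  let ?f = "map_permutation ?R (pick S)"
  have bijp: "bij_betw ?f {p. p permutes ?R} {p. p permutes S}"
  proof (rule bij_betw_byWitness[where f' = "map_permutation S (inv_into ?R (pick S))"])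
    show "\<forall>p\<in>{p. p permutes ?R}. map_permutation S (inv_into ?R (pick S)) (?f p) = p"
      using inj img by (auto intro!: map_permutation_compose_inv[OF bij] simp: inv_into_f_f)
    show "\<forall>p\<in>{p. p permutes S}. ?f (map_permutation S (inv_into ?R (pick S)) p) = p"
      using img by (auto intro!: map_permutation_compose_inv[OF bij_betw_inv_into[OF bij]] simp: f_inv_into_f)
    show "?f ` {p. p permutes ?R} \<subseteq> {p. p permutes S}"
      using map_permutation_permutes[OF bij] by auto
    show "map_permutation S (inv_into ?R (pick S)) ` {p. p permutes S} \<subseteq> {p. p permutes ?R}"
      using map_permutation_permutes[OF bij_betw_inv_into[OF bij]] by auto
  qed
  have "(\<Sum>p | p permutes S. signof p * (\<Prod>i\<in>S. K $$ (i, p i)))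
    = (\<Sum>p | p permutes ?R. signof (?f p) * (\<Prod>i\<in>S. K $$ (i, ?f p i)))"
    by (rule sum.reindex_bij_betw[OF bijp, symmetric])
  also have "\<dots> = (\<Sum>p | p permutes ?R. signof p * (\<Prod>i\<in>?R. submatrix K S S $$ (i, p i)))"
  proof (rule sum.cong[OF refl])
    fix p assume "p \<in> {p. p permutes ?R}"
    hence p: "p permutes ?R" by simp
    have "(\<Prod>i\<in>S. K $$ (i, ?f p i)) = (\<Prod>i\<in>?R. K $$ (pick S i, ?f p (pick S i)))"
      by (rule prod.reindex_bij_betw[OF bij, symmetric])
    also have "\<dots> = (\<Prod>i\<in>?R. submatrix K S S $$ (i, p i))"
    proof (rule prod.cong[OF refl])
      fix i assume i: "i \<in> ?R"
      with p have "p i \<in> ?R" by (simp only: permutes_in_image)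
      with i show "K $$ (pick S i, ?f p (pick S i)) = submatrix K S S $$ (i, p i)"
        using K by (subst submatrix_index) (auto simp: eq map_permutation_apply[OF inj])
    qed
    finally show "signof (?f p) * (\<Prod>i\<in>S. K $$ (i, ?f p i))
      = signof p * (\<Prod>i\<in>?R. submatrix K S S $$ (i, p i))"
      using sign_map_permutation[OF inj p] by simp
  qed
  finally show ?thesis unfolding principal_minor_def det_def'[OF sub] by simp
qed

text \<open>Expand every product in the Leibniz formula over the set \<open>S\<close> of rows whose summand from \<open>K\<close>
  is chosen; a nonzero diagonal summand in the other rows forces the permutation to fix them.\<close>

lemma det_add_diag:
  assumes K: "K \<in> carrier_mat m m"
  shows "det (mat m m (\<lambda>(i, j). K $$ (i, j) + (if i = j then d i else 0)))
    = (\<Sum>S\<in>Pow {0..<m}. (\<Prod>i\<in>{0..<m} - S. d i) * principal_minor K S)"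
proof -
  let ?U = "{0..<m}"
  let ?e = "\<lambda>p i. if i = p i then d i else 0"
  have fix_outside: "(\<Prod>i\<in>?U - S. ?e p i) = (if p permutes S then \<Prod>i\<in>?U - S. d i else 0)"
    if "p permutes ?U" "S \<subseteq> ?U" for p S
  proof (cases "p permutes S")
    case True
    thus ?thesis by (auto intro!: prod.cong simp: permutes_not_in)
  next
    case False
    with permutes_superset[OF that(1), of S] obtain i where "i \<in> ?U - S" "p i \<noteq> i" by blast
    hence "(\<Prod>i\<in>?U - S. ?e p i) = 0" by (intro prod_zero) (auto intro!: bexI[of _ i])
    with False show ?thesis by simp
  qed
  have lt: "p i < m" if "p permutes ?U" "i < m" for p i
    using permutes_in_image[OF that(1), of i] that(2) by simp
  have "det (mat m m (\<lambda>(i, j). K $$ (i, j) + (if i = j then d i else 0)))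
    = (\<Sum>p | p permutes ?U. signof p * (\<Prod>i\<in>?U. K $$ (i, p i) + ?e p i))"
    by (subst det_def'[of _ m], simp)
      (intro sum.cong[OF refl] arg_cong2[where f = "(*)"] refl prod.cong, simp add: lt)
  also have "\<dots> = (\<Sum>p | p permutes ?U. \<Sum>S\<in>Pow ?U.
      (if p permutes S then (\<Prod>i\<in>?U - S. d i) * (signof p * (\<Prod>i\<in>S. K $$ (i, p i))) else 0))"
  proof (rule sum.cong[OF refl])
    fix p assume "p \<in> {p. p permutes ?U}"
    hence p: "p permutes ?U" by simp
    show "signof p * (\<Prod>i\<in>?U. K $$ (i, p i) + ?e p i) = (\<Sum>S\<in>Pow ?U.
      (if p permutes S then (\<Prod>i\<in>?U - S. d i) * (signof p * (\<Prod>i\<in>S. K $$ (i, p i))) else 0))"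
      unfolding prod_add[OF finite_atLeastLessThan] sum_distrib_left
      by (rule sum.cong[OF refl]) (simp add: fix_outside[OF p])
  qed
  also have "\<dots> = (\<Sum>S\<in>Pow ?U. \<Sum>p | p permutes ?U.
      (if p permutes S then (\<Prod>i\<in>?U - S. d i) * (signof p * (\<Prod>i\<in>S. K $$ (i, p i))) else 0))"
    by (rule sum.swap)
  also have "\<dots> = (\<Sum>S\<in>Pow ?U. (\<Prod>i\<in>?U - S. d i) * principal_minor K S)"
  proof (rule sum.cong[OF refl])
    fix S assume "S \<in> Pow ?U"
    hence S: "S \<subseteq> ?U" by simp
    have "{p. p permutes ?U} \<inter> {p. p permutes S} = {p. p permutes S}"
      using permutes_subset[OF _ S] by auto
    thus "(\<Sum>p | p permutes ?U. (if p permutes S then (\<Prod>i\<in>?U - S. d i) * (signof p * (\<Prod>i\<in>S. K $$ (i, p i))) else 0))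
      = (\<Prod>i\<in>?U - S. d i) * principal_minor K S"
      by (simp add: principal_minor_permutes[OF K S] sum_distrib_left sum.If_cases finite_permutations)
  qed
  finally show ?thesis .
qed

lemma principal_minor_coeff_lift:
  fixes K :: "'a :: idom mat"
  shows "principal_minor (map_mat (\<lambda>a. [:a:]) K) S = [:principal_minor K S:]"
proof -
  have "submatrix (map_mat (\<lambda>a. [:a:]) K) S S = map_mat (\<lambda>a. [:a:]) (submatrix K S S)"
    by (rule eq_matI) (auto simp: submatrix_def pick_le)
  thus ?thesis unfolding principal_minor_def by (simp add: coeff_lift_hom.hom_det)
qed

text \<open>\<open>J\<close> collects the rows without t on the diagonal. In the expansion a set
  \<open>S\<close> contributes t^(m - card S) times its minor if it contains \<open>J\<close> within
  the index range, and nothing otherwise.\<close>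

lemma coeff_det_add_X_diag:
  fixes K :: "'a :: idom mat"
  assumes K: "K \<in> carrier_mat m m" and r: "r \<le> m"
  shows "coeff (det (mat m m (\<lambda>(i, j). [:K $$ (i, j):] + (if i = j \<and> i \<notin> J then [:0, 1:] else 0)))) (m - r)
    = (\<Sum>S | S \<in> index_sets r m \<and> J \<inter> {0..<m} \<subseteq> S. principal_minor K S)"
proof -
  let ?U = "{0..<m}"
  have mon: "(pCons 0 1 :: 'a poly) ^ n = monom 1 n" for n by (simp add: monom_altdef)
  have e: "(\<Prod>i\<in>?U - S. if i \<notin> J then [:0, 1::'a:] else 0)
    = (if J \<inter> ?U \<subseteq> S then monom 1 (m - card S) else 0)" if "S \<subseteq> ?U" for S
  proof (cases "J \<inter> ?U \<subseteq> S")
    case True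
    hence "(\<Prod>i\<in>?U - S. if i \<notin> J then [:0, 1::'a:] else 0) = (\<Prod>i\<in>?U - S. [:0, 1:])"
      by (intro prod.cong) auto
    with True that show ?thesis by (simp add: mon card_Diff_subset finite_subset)
  next
    case False
    hence "(\<Prod>i\<in>?U - S. if i \<notin> J then [:0, 1::'a:] else 0) = 0" by (intro prod_zero) auto
    with False show ?thesis by simp
  qed
  have "mat m m (\<lambda>(i, j). [:K $$ (i, j):] + (if i = j \<and> i \<notin> J then [:0, 1:] else 0))
    = mat m m (\<lambda>(i, j). map_mat (\<lambda>a. [:a:]) K $$ (i, j) + (if i = j then (if i \<notin> J then [:0, 1:] else 0) else 0))"
    using K by (intro eq_matI) auto
  hence "coeff (det (mat m m (\<lambda>(i, j). [:K $$ (i, j):] + (if i = j \<and> i \<notin> J then [:0, 1:] else 0)))) (m - r)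
    = (\<Sum>S\<in>Pow ?U. coeff ((\<Prod>i\<in>?U - S. if i \<notin> J then [:0, 1:] else 0) * [:principal_minor K S:]) (m - r))"
    using det_add_diag[of "map_mat (\<lambda>a. [:a:]) K" m "\<lambda>i. if i \<notin> J then [:0, 1:] else 0"] K
    by (simp add: coeff_sum principal_minor_coeff_lift del: mult_pCons_right)
  also have "\<dots> = (\<Sum>S\<in>Pow ?U. if S \<in> index_sets r m \<and> J \<inter> ?U \<subseteq> S then principal_minor K S else 0)"
  proof (rule sum.cong[OF refl])
    fix S assume "S \<in> Pow ?U"
    hence S: "S \<subseteq> ?U" by simp
    hence "card S \<le> m" using card_mono[of ?U S] by simp
    \<comment> \<open>Truncated subtraction is injective here because both \<open>card S\<close> and
      \<open>r\<close> are at most \<open>m\<close>.\<close>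
    with r have "m - card S = m - r \<longleftrightarrow> card S = r" by arith
    with S show "coeff ((\<Prod>i\<in>?U - S. if i \<notin> J then [:0, 1:] else 0) * [:principal_minor K S:]) (m - r)
      = (if S \<in> index_sets r m \<and> J \<inter> ?U \<subseteq> S then principal_minor K S else 0)"
      by (auto simp: e index_sets_def)
  qed
  also have "\<dots> = (\<Sum>S | S \<in> index_sets r m \<and> J \<inter> ?U \<subseteq> S. principal_minor K S)"
    by (subst sum.inter_filter[symmetric]) (auto intro!: sum.cong simp: index_sets_def)
  finally show ?thesis .
qed

text \<open>Laplace expansion along row \<open>j\<close>: the cofactors of that row do not depend on
  its entries, so they survive the replacement.\<close>

lemma scalar_prod_col_adj_mat:
  assumes D: "D \<in> carrier_mat m m" and b: "b \<in> carrier_vec m" and j: "j < m"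
  shows "b \<bullet> col (adj_mat D) j = det (replace_row D b j)"
proof -
  let ?R = "replace_row D b j"
  have R: "?R \<in> carrier_mat m m" using D unfolding replace_row_def by auto
  have "mat_delete ?R j i = mat_delete D j i" for i
    using D by (intro eq_matI) (auto simp: mat_delete_def replace_row_def)
  hence "cofactor ?R j i = cofactor D j i" for i by (simp add: cofactor_def)
  moreover have "?R $$ (j, i) = b $ i" if "i < m" for i using that j D by (simp add: replace_row_def)
  ultimately have "det ?R = (\<Sum>i<m. b $ i * cofactor D j i)"
    unfolding laplace_expansion_row[OF R j] by simp
  also have "\<dots> = b \<bullet> col (adj_mat D) j"
    unfolding scalar_prod_def using D b j by (auto intro!: sum.cong simp: adj_mat_def lessThan_atLeast0)
  finally show ?thesis by simp
qed

section \<open>Coefficients of the adjugate\<close>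

definition coeff_mat :: "nat \<Rightarrow> 'a :: zero poly mat \<Rightarrow> 'a mat" where
  "coeff_mat l = map_mat (\<lambda>p. coeff p l)"

abbreviation const_mat :: "'a :: zero mat \<Rightarrow> 'a poly mat" where
  "const_mat \<equiv> map_mat (\<lambda>a. [:a:])"

lemma coeff_mat_carrier [simp]: "coeff_mat l P \<in> carrier_mat nr nc \<longleftrightarrow> P \<in> carrier_mat nr nc"
  by (simp add: coeff_mat_def)

lemma coeff_mat_mult_const:
  assumes "P \<in> carrier_mat nr n" "N \<in> carrier_mat n nc"
  shows "coeff_mat l (P * const_mat N) = coeff_mat l P * N"
  using assms by (intro eq_matI) (auto simp: coeff_mat_def scalar_prod_def coeff_sum mult.commute)

lemma coeff_mat_const_mult:
  assumes "N \<in> carrier_mat nr n" "P \<in> carrier_mat n nc"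
  shows "coeff_mat l (const_mat N * P) = N * coeff_mat l P"
  using assms by (intro eq_matI) (auto simp: coeff_mat_def scalar_prod_def coeff_sum)

lemma smult_mat_cancel:
  fixes P Q :: "'a :: idom mat"
  assumes eq: "c \<cdot>\<^sub>m P = c \<cdot>\<^sub>m Q" and "c \<noteq> 0"
    and P: "P \<in> carrier_mat nr nc" and Q: "Q \<in> carrier_mat nr nc"
  shows "P = Q"
proof (rule eq_matI)
  fix i j assume ij: "i < dim_row Q" "j < dim_col Q"
  have "(c \<cdot>\<^sub>m P) $$ (i, j) = (c \<cdot>\<^sub>m Q) $$ (i, j)" by (simp only: eq)
  with assms(2) P Q ij show "P $$ (i, j) = Q $$ (i, j)" by simp
qed (use P Q in auto)

text \<open>\<open>D\<close> is \<open>tI + M\<close>; the library's \<open>char_poly_matrix\<close> is \<open>tI - M\<close>, whose minors would carry signs.\<close>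

context
  fixes M :: "'a :: field mat" and m :: nat and D :: "'a poly mat"
  assumes M: "M \<in> carrier_mat m m"
  defines "D \<equiv> char_poly_matrix (- M)"
begin

lemma char_poly_matrix_uminus: "D = [:0, 1:] \<cdot>\<^sub>m 1\<^sub>m m + const_mat M"
  unfolding D_def char_poly_matrix_def using M by (intro eq_matI) auto

lemma char_poly_matrix_uminus_carrier: "D \<in> carrier_mat m m"
  unfolding D_def using M by simp

lemmas adj_D = adj_mat[OF char_poly_matrix_uminus_carrier]

text \<open>Coefficient of t^l in (tI + M) adj D = det D I. The factor t shifts the index by one; l
  = 0 is separate because \<open>l - 1\<close> truncates.\<close>

lemma mult_coeff_adj_mat:
  assumes ij: "i < m" "j < m"
  shows "(M * coeff_mat l (adj_mat D)) $$ (i, j) + (if l = 0 then 0 else coeff_mat (l - 1) (adj_mat D) $$ (i, j))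
    = (if i = j then coeff (det D) l else 0)"
proof -
  have "[:0, 1:] \<cdot>\<^sub>m adj_mat D + const_mat M * adj_mat D = D * adj_mat D"
    unfolding char_poly_matrix_uminus using M adj_D(1) unfolding char_poly_matrix_uminus
    by (subst add_mult_distrib_mat[of _ m m]) (auto simp: mult_smult_assoc_mat[of _ m m])
  also have "\<dots> = det D \<cdot>\<^sub>m 1\<^sub>m m" by (rule adj_D(2))
  finally have "coeff (([:0, 1:] \<cdot>\<^sub>m adj_mat D + const_mat M * adj_mat D) $$ (i, j)) l
    = coeff ((det D \<cdot>\<^sub>m 1\<^sub>m m) $$ (i, j)) l" by simp
  moreover have "coeff ((const_mat M * adj_mat D) $$ (i, j)) l = (M * coeff_mat l (adj_mat D)) $$ (i, j)"
    unfolding coeff_mat_const_mult[OF M adj_D(1), symmetric] using ij M adj_D(1)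
    by (simp add: coeff_mat_def)
  ultimately show ?thesis using ij M adj_D(1)
    by (auto simp: coeff_mat_def coeff_pCons add.commute split: nat.splits)
qed

lemma coeff_adj_mat_0: "M * coeff_mat 0 (adj_mat D) = coeff (det D) 0 \<cdot>\<^sub>m 1\<^sub>m m"
  using mult_coeff_adj_mat[of _ _ 0] M adj_D(1) by (intro eq_matI) (auto simp: coeff_mat_def)

lemma coeff_adj_mat_Suc:
  "M * coeff_mat (Suc l) (adj_mat D) + coeff_mat l (adj_mat D) = coeff (det D) (Suc l) \<cdot>\<^sub>m 1\<^sub>m m"
  using mult_coeff_adj_mat[of _ _ "Suc l"] M adj_D(1) by (intro eq_matI) (auto simp: coeff_mat_def)

text \<open>While the coefficients of \<open>det D\<close> vanish, the recursion reads M C_(l+1) = -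
  C_l, so each further factor \<open>M\<close> lowers the index by one until M C_0 = 0.\<close>

lemma pow_mult_coeff_adj_mat_eq_0:
  assumes "\<And>i. i \<le> l \<Longrightarrow> coeff (det D) i = 0"
  shows "M ^\<^sub>m Suc l * coeff_mat l (adj_mat D) = 0\<^sub>m m m"
  using assms
proof (induction l)
  case 0
  thus ?case using coeff_adj_mat_0 M by (auto intro!: eq_matI)
next
  case (Suc l)
  let ?C = "\<lambda>l. coeff_mat l (adj_mat D)" and ?Ml = "M ^\<^sub>m Suc l"
  have C: "?C i \<in> carrier_mat m m" for i using adj_D(1) by simp
  have Ml: "?Ml \<in> carrier_mat m m" by (rule pow_carrier_mat[OF M])
  have "0 \<cdot>\<^sub>m 1\<^sub>m m = (0\<^sub>m m m :: 'a mat)" by (intro eq_matI) auto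
  hence "0\<^sub>m m m = ?Ml * (M * ?C (Suc l) + ?C l)"
    unfolding coeff_adj_mat_Suc using Suc.prems[of "Suc l"] right_mult_zero_mat[OF Ml] by simp
  also have "\<dots> = ?Ml * (M * ?C (Suc l)) + ?Ml * ?C l"
    using M C by (intro mult_add_distrib_mat[OF Ml]) auto
  also have "\<dots> = ?Ml * (M * ?C (Suc l))" using Suc.IH Suc.prems Ml M C by simp
  also have "\<dots> = M ^\<^sub>m Suc (Suc l) * ?C (Suc l)" using assoc_mult_mat[OF Ml M C] by simp
  finally show ?case by simp
qed

text \<open>\<open>A\<close> commutes with \<open>D\<close>, hence with its adjugate, as \<open>det D\<close> is a monic
  polynomial and can be cancelled.\<close>

lemma coeff_adj_mat_commute:
  assumes A: "A \<in> carrier_mat m m" and comm: "A * M = M * A"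
  shows "A * coeff_mat l (adj_mat D) = coeff_mat l (adj_mat D) * A"
proof -
  let ?A = "const_mat A" and ?J = "adj_mat D"
  note D = char_poly_matrix_uminus_carrier and J = adj_D(1)
  have A': "?A \<in> carrier_mat m m" and M': "const_mat M \<in> carrier_mat m m" using A M by auto
  have "?A * const_mat M = const_mat M * ?A"
    using coeff_lift_hom.mat_hom_mult[OF A M] coeff_lift_hom.mat_hom_mult[OF M A] comm by simp
  hence AD: "?A * D = D * ?A"
    unfolding char_poly_matrix_uminus using A' M'
    by (simp add: mult_add_distrib_mat[of _ m m _ m] add_mult_distrib_mat[of _ m m _ _ m]
      mult_smult_distrib[of _ m m _ m] mult_smult_assoc_mat[of _ m m _ m])
  \<comment> \<open>Write det D I as adj D times D on the left, move \<open>?A\<close> past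
    \<open>D\<close>, then read D adj D on the right as det D I again.\<close>
  have "det D \<cdot>\<^sub>m (?A * ?J) = (det D \<cdot>\<^sub>m 1\<^sub>m m) * (?A * ?J)"
    using A' J by (simp add: mult_smult_assoc_mat[of _ m m _ m])
  also have "\<dots> = ?J * (D * ?A) * ?J" unfolding adj_D(3)[symmetric]
    using A' J D by (simp add: assoc_mult_mat[of _ m m _ m _ m] mult_carrier_mat[of _ m m _ m])
  also have "\<dots> = ?J * ?A * (D * ?J)" unfolding AD[symmetric]
    using A' J D by (simp add: assoc_mult_mat[of _ m m _ m _ m] mult_carrier_mat[of _ m m _ m])
  also have "\<dots> = det D \<cdot>\<^sub>m (?J * ?A)" unfolding adj_D(2)
    using A' J by (simp add: mult_smult_distrib[of _ m m _ m])
  finally have eq: "det D \<cdot>\<^sub>m (?A * ?J) = det D \<cdot>\<^sub>m (?J * ?A)" .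
  have "det D \<noteq> 0"
    using degree_monic_char_poly[of "- M" m] M unfolding D_def char_poly_def by auto
  hence "?A * ?J = ?J * ?A"
    by (rule smult_mat_cancel[OF eq _ mult_carrier_mat[OF A' J] mult_carrier_mat[OF J A']])
  thus ?thesis using coeff_mat_const_mult[OF A J] coeff_mat_mult_const[OF J A] by metis
qed

text \<open>The case of empty \<open>J\<close>, since every diagonal entry of \<open>D\<close>
  carries t. This is the denominator of the formula.\<close>

lemma coeff_det_char_poly_matrix:
  assumes r: "r \<le> m"
  shows "coeff (det D) (m - r) = (\<Sum>\<alpha>\<in>index_sets r m. principal_minor M \<alpha>)"
proof -
  have "D = mat m m (\<lambda>(i, j). [:M $$ (i, j):] + (if i = j \<and> i \<notin> {} then [:0, 1:] else 0))"
    unfolding char_poly_matrix_uminus using M by (intro eq_matI) auto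
  thus ?thesis using coeff_det_add_X_diag[OF M r, of "{}"] by simp
qed

text \<open>Pairing with a constant vector commutes with taking coefficients. The replaced row
  \<open>j\<close> is the only one without t, so \<open>J\<close> is the singleton of
  \<open>j\<close> and only index sets containing \<open>j\<close> survive. This is the
  numerator.\<close>

lemma scalar_prod_coeff_adj_mat:
  assumes b: "b \<in> carrier_vec m" and j: "j < m" and r: "r \<le> m"
  shows "b \<bullet> col (coeff_mat (m - r) (adj_mat D)) j
    = (\<Sum>\<alpha>\<in>index_sets_containing r m j. principal_minor (replace_row M b j) \<alpha>)"
proof -
  let ?b = "map_vec (\<lambda>a. [:a:]) b" and ?K = "replace_row M b j"
  have b': "?b \<in> carrier_vec m" using b by simp
  have K: "?K \<in> carrier_mat m m" using M by (auto simp: replace_row_def)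
  have "b \<bullet> col (coeff_mat (m - r) (adj_mat D)) j = coeff (?b \<bullet> col (adj_mat D) j) (m - r)"
    using b j adj_D(1) by (auto simp: scalar_prod_def coeff_sum coeff_mat_def intro!: sum.cong)
  also have "\<dots> = coeff (det (replace_row D ?b j)) (m - r)"
    unfolding scalar_prod_col_adj_mat[OF char_poly_matrix_uminus_carrier b' j] ..
  also have "replace_row D ?b j
    = mat m m (\<lambda>(p, q). [:?K $$ (p, q):] + (if p = q \<and> p \<notin> {j} then [:0, 1:] else 0))"
    unfolding char_poly_matrix_uminus using M b by (intro eq_matI) (auto simp: replace_row_def)
  also have "coeff (det \<dots>) (m - r) = (\<Sum>\<alpha>\<in>index_sets_containing r m j. principal_minor ?K \<alpha>)"
    unfolding coeff_det_add_X_diag[OF K r] using j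
    by (intro sum.cong) (auto simp: index_sets_containing_def)
  finally show ?thesis .
qed

end

section \<open>The Drazin inverse\<close>

text \<open>Iterates X = X A X, using that \<open>X\<close> commutes with \<open>A\<close>; taking l
  to be the index makes the factor \<open>A ^\<^sub>m k\<close> available.\<close>

lemma is_drazin_inverse_pow:
  assumes A: "A \<in> carrier_mat m m" and X: "is_drazin_inverse A X"
  shows "X = X ^\<^sub>m Suc l * A ^\<^sub>m l"
proof (induction l)
  case 0
  thus ?case using A X by (auto simp: is_drazin_inverse_def)
next
  case (Suc l)
  have Xc: "X \<in> carrier_mat m m" and XAX: "X * A * X = X" and c: "A * X = X * A"
    using A X by (auto simp: is_drazin_inverse_def)
  have P: "A ^\<^sub>m i \<in> carrier_mat m m" "X ^\<^sub>m i \<in> carrier_mat m m" for i using A Xc by auto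
  note as = assoc_mult_mat[of _ m m _ m _ m] mult_carrier_mat[of _ m m _ m]
  have "X ^\<^sub>m Suc (Suc l) * A ^\<^sub>m Suc l = X ^\<^sub>m Suc l * (X * A) * A ^\<^sub>m l"
    using P A Xc pow_mat_commute[OF A, of l] by (simp add: as)
  also have "\<dots> = X ^\<^sub>m l * (X * A * X) * A ^\<^sub>m l"
    using P A Xc c by (simp add: as)
  also have "\<dots> = X" using Suc XAX P Xc by simp
  finally show ?case by simp
qed

text \<open>Both inverses equal Y A X: expand \<open>Y\<close> as a power times
  \<open>A ^\<^sub>m ?k\<close> and absorb A X, or expand \<open>X\<close> with
  \<open>A ^\<^sub>m ?k\<close> on the left and extract Y A.\<close>

lemma is_drazin_inverse_unique:
  assumes A: "A \<in> carrier_mat m m" and X: "is_drazin_inverse A X" and Y: "is_drazin_inverse A Y"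
  shows "X = Y"
proof -
  let ?k = "mat_index A"
  have Z: "Z \<in> carrier_mat m m" "A * Z = Z * A" "A ^\<^sub>m ?k * A * Z = A ^\<^sub>m ?k"
    if "is_drazin_inverse A Z" for Z using that A by (auto simp: is_drazin_inverse_def)
  have P: "A ^\<^sub>m i \<in> carrier_mat m m" "X ^\<^sub>m i \<in> carrier_mat m m" "Y ^\<^sub>m i \<in> carrier_mat m m" for i
    using A Z(1)[OF X] Z(1)[OF Y] by auto
  note as = assoc_mult_mat[of _ m m _ m _ m] mult_carrier_mat[of _ m m _ m]
  have "Y = Y ^\<^sub>m Suc ?k * (A ^\<^sub>m ?k * A * X)"
    unfolding Z(3)[OF X] by (rule is_drazin_inverse_pow[OF A Y])
  also have "\<dots> = Y ^\<^sub>m Suc ?k * A ^\<^sub>m ?k * (A * X)" using P A Z(1)[OF X] Z(1)[OF Y] by (simp add: as)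
  also have "\<dots> = Y * (A * X)" using is_drazin_inverse_pow[OF A Y, of ?k] by simp
  finally have "Y = Y * (A * X)" .
  moreover have "X = Y * (A * X)"
  proof -
    have "X = A ^\<^sub>m ?k * X ^\<^sub>m Suc ?k"
      using is_drazin_inverse_pow[OF A X, of ?k] pow_mat_commute_pow[OF Z(2)[OF X] A Z(1)[OF X], of ?k "Suc ?k"] by simp
    note eq = this
    have "A ^\<^sub>m ?k = A ^\<^sub>m Suc ?k * Y" using Z(3)[OF Y] by simp
    also have "\<dots> = Y * A ^\<^sub>m Suc ?k" using pow_mat_commute_pow[OF Z(2)[OF Y] A Z(1)[OF Y], of "Suc ?k" 1] Z(1)[OF Y] by simp
    also have "\<dots> = Y * (A * A ^\<^sub>m ?k)" using pow_mat_commute[OF A] by simp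
    finally have "A ^\<^sub>m ?k * X ^\<^sub>m Suc ?k = Y * (A * A ^\<^sub>m ?k) * X ^\<^sub>m Suc ?k"
      by (rule arg_cong)
    also have "\<dots> = Y * (A * (A ^\<^sub>m ?k * X ^\<^sub>m Suc ?k))" using P(1,2) A Z(1)[OF Y] Z(1)[OF X] by (simp add: as)
    finally have "A ^\<^sub>m ?k * X ^\<^sub>m Suc ?k = Y * (A * (A ^\<^sub>m ?k * X ^\<^sub>m Suc ?k))" .
    thus ?thesis using eq by simp
  qed
  ultimately show ?thesis by simp
qed

text \<open>\<open>C\<close> and \<open>d\<close> stand for the coefficients at t^s of the adjugate
  and the determinant; the equations follow from \<open>eq\<close> and commutation.\<close>

lemma is_drazin_inverseI:
  assumes A: "A \<in> carrier_mat m m" and k: "mat_index A = k"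
    and C: "C \<in> carrier_mat m m" and comm: "A * C = C * A" "A ^\<^sub>m (k + 1) * C = C * A ^\<^sub>m (k + 1)"
    and eq: "A ^\<^sub>m k * (A ^\<^sub>m (k + 1) * C) = d \<cdot>\<^sub>m A ^\<^sub>m k" and d: "d \<noteq> 0"
  shows "is_drazin_inverse A (inverse d \<cdot>\<^sub>m (A ^\<^sub>m k * C))"
proof -
  define Q where "Q = A ^\<^sub>m k"
  define M where "M = A ^\<^sub>m (k + 1)"
  have Q: "Q \<in> carrier_mat m m" and M: "M \<in> carrier_mat m m" unfolding Q_def M_def using A by auto
  note cs = A C Q M mult_carrier_mat[of _ m m _ m]
  note as = assoc_mult_mat[of _ m m _ m _ m]
  note sm = mult_smult_distrib[of _ m m _ m] mult_smult_assoc_mat[of _ m m _ m]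
  have AQ: "A * Q = Q * A" "Q * A = M" "M * Q = Q * M"
    using pow_mat_commute[OF A, of k] pow_mat_add[OF A, of k "k + 1"] pow_mat_add[OF A, of "k + 1" k]
    by (simp_all add: Q_def M_def add.commute)
  have QMC: "Q * (M * C) = d \<cdot>\<^sub>m Q" using eq by (simp add: Q_def M_def)
  have dd: "inverse d \<cdot>\<^sub>m (d \<cdot>\<^sub>m Z) = Z" for Z :: "complex mat"
    using d by (intro eq_matI) auto
  let ?X = "inverse d \<cdot>\<^sub>m (Q * C)"
  have X: "?X \<in> carrier_mat m m" using cs by simp
  have "M * ?X = inverse d \<cdot>\<^sub>m (M * Q * C)" using cs by (simp add: as sm)
  also have "\<dots> = inverse d \<cdot>\<^sub>m (Q * (M * C))" unfolding AQ(3) using cs by (simp add: as)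
  finally have 1: "M * ?X = Q" unfolding QMC dd .
  have "A * ?X = inverse d \<cdot>\<^sub>m (A * Q * C)" using cs by (simp add: as sm)
  also have "\<dots> = inverse d \<cdot>\<^sub>m (Q * (A * C))" unfolding AQ(1) using cs by (simp add: as)
  also have "\<dots> = ?X * A" unfolding comm(1) using cs by (simp add: as sm)
  finally have 2: "A * ?X = ?X * A" .
  \<comment> \<open>The inner factor Q C A Q equals Q M C, that is d Q, which cancels one of the two
    inverses of \<open>d\<close>.\<close>
  have "?X * A * ?X = inverse d \<cdot>\<^sub>m (inverse d \<cdot>\<^sub>m (Q * (C * (A * Q)) * C))" using cs by (simp add: as sm)
  also have "Q * (C * (A * Q)) = d \<cdot>\<^sub>m Q"
    unfolding AQ(1,2) comm(2)[folded M_def, symmetric] by (rule QMC)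
  also have "inverse d \<cdot>\<^sub>m (d \<cdot>\<^sub>m Q * C) = Q * C" using cs dd by (simp add: sm)
  finally have 3: "?X * A * ?X = ?X" .
  show ?thesis unfolding is_drazin_inverse_def k using X 1 2 3 A by (simp add: Q_def M_def)
qed

section \<open>Cramer-type formula for the Drazin inverse solution\<close>

theorem theorem3p4:
  fixes A B :: "complex mat" and m n k r :: nat
  assumes "A \<in> carrier_mat m m"
    and "B \<in> carrier_mat n m"
    and "mat_index A = k"
    and "mat_rank (A ^\<^sub>m (k + 1)) = r"
    and "mat_rank (A ^\<^sub>m k) = r"
    and "1 \<le> r" and "r \<le> m"
  shows "(\<Sum>\<alpha>\<in>index_sets r m. principal_minor (A ^\<^sub>m (k + 1)) \<alpha>) \<noteq> 0 \<and>
    (\<forall>i<n. \<forall>j<m.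
      (B * drazin_inverse A) $$ (i, j) =
        (\<Sum>\<alpha>\<in>index_sets_containing r m j.
            principal_minor (replace_row (A ^\<^sub>m (k + 1)) (row (B * A ^\<^sub>m k) i) j) \<alpha>) /
        (\<Sum>\<alpha>\<in>index_sets r m. principal_minor (A ^\<^sub>m (k + 1)) \<alpha>))"
proof -
  note A = assms(1) and B = assms(2) and r = assms(7)
  define M where "M = A ^\<^sub>m (k + 1)"
  define D where "D = char_poly_matrix (- M)"
  define C where "C = (\<lambda>l. coeff_mat l (adj_mat D))"
  define s where "s = m - r"
  define d where "d = coeff (det D) s"
  have P: "A ^\<^sub>m l \<in> carrier_mat m m" for l using A by simp
  have M: "M \<in> carrier_mat m m" unfolding M_def by (rule P)
  have D: "D \<in> carrier_mat m m" unfolding D_def using M by simp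
  have C: "C l \<in> carrier_mat m m" for l unfolding C_def using adj_mat(1)[OF D] by simp

  have rank: "vec_space.rank m M = r" "vec_space.rank m (A ^\<^sub>m k) = r"
    using assms(4,5) A P by (simp_all add: M_def)
  have kd: "kernel_dim M = s" "kernel_dim (A ^\<^sub>m k) = s"
    using rank_plus_kernel_dim[OF M] rank_plus_kernel_dim[OF P, of k] rank by (simp_all add: s_def)
  hence stable: "mat_kernel (A ^\<^sub>m (k + l)) = mat_kernel (A ^\<^sub>m k)" for l
    using mat_kernel_pow_stable[OF A, of k l] by (simp add: M_def)

  \<comment> \<open>The square is a power of \<open>A\<close> with exponent at least k, so its
    kernel again has dimension \<open>s\<close>; thus the multiplicity lemma applies to
    \<open>- M\<close>.\<close>
  have "- M * - M = M * M" using M by simp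
  also have "\<dots> = A ^\<^sub>m (k + (k + 2))"
    using pow_mat_add[OF A, of "k + 1" "k + 1"] by (simp add: M_def)
  finally have "- M * - M = A ^\<^sub>m (k + (k + 2))" .
  hence "kernel_dim (- M * - M) = s"
    using kernel_dim_cong[OF _ stable[of "k + 2"]] P kd(2) by (metis carrier_matD(2))
  moreover have "kernel_dim (- M) = s"
    using kernel_dim_cong[OF _ mat_kernel_uminus, of M] kd(1) by simp
  ultimately have order: "order 0 (det D) = s"
    using order_0_char_poly_eq_kernel_dim[of "- M" m] M by (simp add: D_def char_poly_def)
  have "det D \<noteq> 0"
    using degree_monic_char_poly[of "- M" m] M unfolding D_def char_poly_def by auto
  \<comment> \<open>Splitting off t^s leaves a cofactor \<open>q\<close> with nonzero constant term,
    and that term is \<open>d\<close>.\<close>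
  from order_decomp[OF this, of 0] order obtain q
    where q: "det D = monom 1 s * q" "\<not> [:0, 1:] dvd q" by (auto simp: monom_altdef)
  have low: "coeff (det D) l = 0" if "l < s" for l using that unfolding q(1) by (simp add: coeff_monom_mult)
  have "d = coeff q 0" unfolding d_def q(1) by (simp add: coeff_monom_mult)
  hence d0: "d \<noteq> 0" using q(2) dvd_iff_poly_eq_0[of 0 q] by (simp add: poly_0_coeff_0)

  have comm: "U * C l = C l * U" if "U \<in> carrier_mat m m" "U * M = M * U" for U l
    unfolding C_def D_def by (rule coeff_adj_mat_commute[OF M that])
  have QMC: "A ^\<^sub>m k * (M * C s) = d \<cdot>\<^sub>m A ^\<^sub>m k"
  \<comment> \<open>For s = 0 there is no preceding coefficient of the adjugate, and M C_0 = d I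
    holds outright.\<close>
  proof (cases s)
    case 0
    thus ?thesis using coeff_adj_mat_0[OF M] mult_smult_distrib[OF P one_carrier_mat] right_mult_one_mat[OF P]
      by (simp add: C_def d_def D_def)
  next
    case (Suc t)
    have "M ^\<^sub>m Suc t * C t = 0\<^sub>m m m"
      unfolding C_def D_def by (rule pow_mult_coeff_adj_mat_eq_0[OF M]) (use low Suc in \<open>simp add: D_def\<close>)
    \<comment> \<open>The exponent (k + 1)(t + 1) is at least k, so by \<open>stable\<close> this
      power has the kernel of \<open>A ^\<^sub>m k\<close>, which therefore also annihilates
      \<open>C t\<close>.\<close>
    moreover have "M ^\<^sub>m Suc t = A ^\<^sub>m (k + (1 + (k + 1) * t))"
      unfolding M_def pow_mat_mult[OF A] by (simp add: algebra_simps)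
    ultimately have "A ^\<^sub>m k * C t = 0\<^sub>m m m"
      using mult_mat_eq_0_imp[OF P P C] stable by (metis order_refl)
    moreover have "A ^\<^sub>m k * (M * C s + C t) = d \<cdot>\<^sub>m A ^\<^sub>m k"
      using coeff_adj_mat_Suc[OF M, of t] mult_smult_distrib[OF P one_carrier_mat] right_mult_one_mat[OF P]
      by (simp add: C_def d_def D_def Suc)
    ultimately show ?thesis
      using mult_add_distrib_mat[OF P mult_carrier_mat[OF M C] C, of k s t] P[of k] M C by simp
  qed

  have AM: "A * M = M * A" unfolding M_def by (rule pow_mat_commute[OF A])
  have "is_drazin_inverse A (inverse d \<cdot>\<^sub>m (A ^\<^sub>m k * C s))"
    by (rule is_drazin_inverseI[OF A assms(3) C comm[OF A AM]])
      (use comm[OF M refl] QMC d0 in \<open>simp_all add: M_def\<close>)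
  hence X: "drazin_inverse A = inverse d \<cdot>\<^sub>m (A ^\<^sub>m k * C s)"
    unfolding drazin_inverse_def using is_drazin_inverse_unique[OF A] by (intro the_equality) auto

  \<comment> \<open>Identifies \<open>d\<close> with the denominator, so \<open>d0\<close> also
    settles that it is nonzero.\<close>
  have d: "d = (\<Sum>\<alpha>\<in>index_sets r m. principal_minor M \<alpha>)"
    unfolding d_def s_def D_def by (rule coeff_det_char_poly_matrix[OF M r])
  have "(B * drazin_inverse A) $$ (i, j)
    = (\<Sum>\<alpha>\<in>index_sets_containing r m j. principal_minor (replace_row M (row (B * A ^\<^sub>m k) i) j) \<alpha>) / d"
    if ij: "i < n" "j < m" for i j
  proof -
    have "B * drazin_inverse A = inverse d \<cdot>\<^sub>m (B * A ^\<^sub>m k * C s)"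
      unfolding X using B P[of k] C[of s] mult_smult_distrib[OF B mult_carrier_mat[OF P C]]
      by (simp add: assoc_mult_mat[OF B P C])
    hence "(B * drazin_inverse A) $$ (i, j) = (row (B * A ^\<^sub>m k) i \<bullet> col (C s) j) / d"
      using ij B C[of s] by (simp add: divide_inverse mult.commute)
    moreover have "row (B * A ^\<^sub>m k) i \<in> carrier_vec m"
      using row_carrier_vec[OF ij(1) mult_carrier_mat[OF B P]] .
    ultimately show ?thesis
      using scalar_prod_coeff_adj_mat[OF M _ ij(2) r] by (simp add: C_def D_def s_def)
  qed
  with d d0 show ?thesis unfolding M_def by simp
qed

end
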